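(* (The generalized Bianchi identity) Let $E\to M$ be a smooth vector bundle, $K$ a linear connection on $E$ and $\Gamma$ a classical (linear symmetric) connection on $M$. Let $\nabla=\nabla^{(K,\Gamma)}$ and let $R[K]_j{}^i{}_{\lambda\mu;\nu}$ be the components of the covariant differential $\nabla R[K]=R[K]_j{}^i{}_{\lambda\mu;\nu}\,\mathbf b^j\otimes\mathbf b_i\otimes d^\lambda\wedge d^\mu\otimes d^\nu$ of the curvature tensor $R[K]:M\to E^*\otimes E\otimes\Lambda^2T^*M$. Then $$R[K]_j{}^i{}_{\lambda\mu;\nu}+R[K]_j{}^i{}_{\mu\nu;\lambda}+R[K]_j{}^i{}_{\nu\lambda;\mu}=0 .$$
   Context: All manifolds and maps are smooth; the summation convention over repeated indices is used (sums over all values of the indices). $(x^\lambda,y^i)$ are local linear fiber coordinates on $E$; $\mathbf b_i$, $\mathbf b^i$ are the corresponding local bases of sections of $E$, $E^*$; $d^\lambda=dx^\lambda$, $\partial_\lambda=\partial/\partial x^\lambda$, $\partial_i=\partial/\partial y^i$. A linear connection on $E\to M$ is a linear splitting $K:E\to J^1E$, equivalently a tangent-valued 1-form $K=d^\lambda\otimes(\partial_\lambda+K_j{}^i{}_\lambda\,y^j\,\partial_i)$. Its covariant differential is $\nabla^K\Phi=j^1\Phi-K\circ\Phi$, i.e. $\nabla^K(\phi^i\mathbf b_i)=(\partial_\lambda\phi^i-K_j{}^i{}_\lambda\phi^j)\,\mathbf b_i\otimes d^\lambda$. A classical connection $\Gamma$ on $M$ is a linear symmetric connection on $TM\to M$,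 $\Gamma=d^\lambda\otimes(\partial_\lambda+\Gamma_\nu{}^\mu{}_\lambda\,\dot x^\nu\,\partial/\partial\dot x^\mu)$ with $\Gamma_\mu{}^\lambda{}_\nu=\Gamma_\nu{}^\lambda{}_\mu$ (note the sign convention: covariant derivatives of vector fields carry $-\Gamma$). The curvature of $K$ is $R[K]=-[K,K]$ (Frölicher–Nijenhuis bracket), regarded as a section of $E^*\otimes E\otimes\Lambda^2T^*M$: $R[K]=R[K]_j{}^i{}_{\lambda\mu}\,\mathbf b^j\otimes\mathbf b_i\otimes d^\lambda\wedge d^\mu$ with $$R[K]_j{}^i{}_{\lambda\mu}=\partial_\mu K_j{}^i{}_\lambda-\partial_\lambda K_j{}^i{}_\mu+K_j{}^p{}_\mu K_p{}^i{}_\lambda-K_j{}^p{}_\lambda K_p{}^i{}_\mu .$$ $\nabla^{(K,\Gamma)}$ denotes the covariant differential of sections of tensor products of copies of $E,E^*,TM,T^*M$ with respect to the tensor product connection induced by $K$, its dual $K^*$, $\Gamma$, and its dual $\Gamma^*$. For $R[K]$ this gives $$R[K]_j{}^i{}_{\lambda\mu;\nu}=\partial_\nu R[K]_j{}^i{}_{\lambda\mu}-K_p{}^i{}_\nu R[K]_j{}^p{}_{\lambda\mu}+K_j{}^p{}_\nu R[K]_p{}^i{}_{\lambda\mu}+\Gamma_\nu{}^\rho{}_\lambda R[K]_j{}^i{}_{\rho\mu}+\Gamma_\nu{}^\rho{}_\mu R[K]_j{}^i{}_{\lambda\rho}.$$ *)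

theory Defs
  imports "HOL-Analysis.Analysis"
begin

section \<open>Smooth maps between open subsets of normed spaces\<close>

text \<open>
  Iterated directional derivatives; the source spaces used below are finite dimensional and
  the sets open, so this is the usual notion of a \<open>C\<^sup>n\<close> map.
\<close>

primrec Ck_on :: "nat \<Rightarrow> 'a::real_normed_vector set \<Rightarrow> ('a \<Rightarrow> 'b::real_normed_vector) \<Rightarrow> bool" where
  "Ck_on 0 = (\<lambda>S f. continuous_on S f)"
| "Ck_on (Suc n) = (\<lambda>S f. f differentiable_on S \<and>
      (\<forall>v. Ck_on n S (\<lambda>x. frechet_derivative f (at x) v)))"

definition smooth_on :: "'a::real_normed_vector set \<Rightarrow> ('a \<Rightarrow> 'b::real_normed_vector) \<Rightarrow> bool" where
  "smooth_on S f \<longleftrightarrow> (\<forall>n. Ck_on n S f)"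

definition pderiv_at :: "(real^'m \<Rightarrow> real) \<Rightarrow> 'm \<Rightarrow> real^'m \<Rightarrow> real" where
  "pderiv_at f \<kappa> \<xi> = frechet_derivative f (at \<xi>) (axis \<kappa> 1)"


section \<open>Smooth manifolds\<close>

text \<open>A chart is a pair of its domain and its coordinate map.\<close>

type_synonym ('p, 'm) chart = "'p set \<times> ('p \<Rightarrow> real^'m)"

record ('p, 'm::finite) manifold =
  mtop :: "'p topology"
  atlas :: "('p, 'm) chart set"

definition chart_inv :: "('p, 'm::finite) chart \<Rightarrow> real^'m \<Rightarrow> 'p" where
  "chart_inv c = inv_into (fst c) (snd c)"

definition is_chart :: "'p topology \<Rightarrow> ('p, 'm::finite) chart \<Rightarrow> bool" where
  "is_chart X c \<longleftrightarrow> openin X (fst c) \<and> open (snd c ` fst c) \<and>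
     homeomorphic_map (subtopology X (fst c)) (top_of_set (snd c ` fst c)) (snd c)"

definition compatible_charts :: "('p, 'm::finite) chart \<Rightarrow> ('p, 'm) chart \<Rightarrow> bool" where
  "compatible_charts c d \<longleftrightarrow>
     smooth_on (snd c ` (fst c \<inter> fst d)) (snd d \<circ> chart_inv c) \<and>
     smooth_on (snd d ` (fst c \<inter> fst d)) (snd c \<circ> chart_inv d)"

definition smooth_manifold :: "('p, 'm::finite) manifold \<Rightarrow> bool" where
  "smooth_manifold M \<longleftrightarrow>
     Hausdorff_space (mtop M) \<and> second_countable (mtop M) \<and>
     (\<forall>c\<in>atlas M. is_chart (mtop M) c) \<and>
     (\<Union>c\<in>atlas M. fst c) = topspace (mtop M) \<and>
     (\<forall>c\<in>atlas M. \<forall>d\<in>atlas M. compatible_charts c d)"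

text \<open>The maximal atlas: all local coordinate systems of \<open>M\<close>.\<close>

definition charts :: "('p, 'm::finite) manifold \<Rightarrow> ('p, 'm) chart set" where
  "charts M = {c. is_chart (mtop M) c \<and> (\<forall>d\<in>atlas M. compatible_charts c d)}"

definition smooth_fun_on ::
    "('p, 'm::finite) manifold \<Rightarrow> 'p set \<Rightarrow> ('p \<Rightarrow> 'b::real_normed_vector) \<Rightarrow> bool" where
  "smooth_fun_on M W f \<longleftrightarrow>
     (\<forall>c\<in>charts M. smooth_on (snd c ` (fst c \<inter> W)) (f \<circ> chart_inv c))"


section \<open>Smooth vector bundles\<close>

text \<open>
  A trivialization is a pair \<open>(V, y)\<close> of an open subset of the base and the fiber coordinates
  \<open>y = (y\<^sup>i)\<close> on the part of the total space over \<open>V\<close>. The topology and the smooth structure of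
  the total space are the ones determined by the trivializations.
\<close>

type_synonym ('p, 'e, 'k) trivialization = "'p set \<times> ('e \<Rightarrow> real^'k)"

record ('p, 'm::finite, 'e, 'k::finite) vbundle =
  base :: "('p, 'm) manifold"
  total :: "'e set"
  proj :: "'e \<Rightarrow> 'p"
  fadd :: "'e \<Rightarrow> 'e \<Rightarrow> 'e"
  fscale :: "real \<Rightarrow> 'e \<Rightarrow> 'e"
  triv_atlas :: "('p, 'e, 'k) trivialization set"

definition fiber :: "('p, 'm::finite, 'e, 'k::finite) vbundle \<Rightarrow> 'p \<Rightarrow> 'e set" where
  "fiber E p = {e \<in> total E. proj E e = p}"

definition is_triv ::
    "('p, 'm::finite, 'e, 'k::finite) vbundle \<Rightarrow> ('p, 'e, 'k) trivialization \<Rightarrow> bool" where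
  "is_triv E t \<longleftrightarrow> openin (mtop (base E)) (fst t) \<and>
     (\<forall>p\<in>fst t. bij_betw (snd t) (fiber E p) UNIV \<and>
        (\<forall>e\<in>fiber E p. \<forall>f\<in>fiber E p. snd t (fadd E e f) = snd t e + snd t f) \<and>
        (\<forall>a. \<forall>e\<in>fiber E p. snd t (fscale E a e) = a *\<^sub>R snd t e))"

text \<open>The vector over \<open>p\<close> with fiber coordinates \<open>\<eta>\<close>; for \<open>\<eta> = axis j 1\<close> it is \<open>b\<^sub>j(p)\<close>.\<close>

definition fvec ::
    "('p, 'm::finite, 'e, 'k::finite) vbundle \<Rightarrow> ('p, 'e, 'k) trivialization \<Rightarrow>
      'p \<Rightarrow> real^'k \<Rightarrow> 'e" where
  "fvec E t p \<eta> = inv_into (fiber E p) (snd t) \<eta>"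

definition compatible_trivs ::
    "('p, 'm::finite, 'e, 'k::finite) vbundle \<Rightarrow> ('p, 'e, 'k) trivialization \<Rightarrow>
      ('p, 'e, 'k) trivialization \<Rightarrow> bool" where
  "compatible_trivs E t u \<longleftrightarrow>
     (\<forall>\<eta>. smooth_fun_on (base E) (fst t \<inter> fst u) (\<lambda>p. snd u (fvec E t p \<eta>)) \<and>
          smooth_fun_on (base E) (fst t \<inter> fst u) (\<lambda>p. snd t (fvec E u p \<eta>)))"

text \<open>
  The vector space axioms for the fibers are not listed: they follow from the fiberwise
  linearity and bijectivity of the trivializations.
\<close>

definition smooth_vector_bundle :: "('p, 'm::finite, 'e, 'k::finite) vbundle \<Rightarrow> bool" where
  "smooth_vector_bundle E \<longleftrightarrow>
     smooth_manifold (base E) \<and>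
     proj E ` total E \<subseteq> topspace (mtop (base E)) \<and>
     (\<forall>p. \<forall>e\<in>fiber E p. \<forall>f\<in>fiber E p. fadd E e f \<in> fiber E p) \<and>
     (\<forall>p a. \<forall>e\<in>fiber E p. fscale E a e \<in> fiber E p) \<and>
     (\<forall>t\<in>triv_atlas E. is_triv E t) \<and>
     (\<Union>t\<in>triv_atlas E. fst t) = topspace (mtop (base E)) \<and>
     (\<forall>t\<in>triv_atlas E. \<forall>u\<in>triv_atlas E. compatible_trivs E t u)"

text \<open>All local linear fiber coordinates of \<open>E\<close> (the maximal trivializing atlas).\<close>

definition trivs ::
    "('p, 'm::finite, 'e, 'k::finite) vbundle \<Rightarrow> ('p, 'e, 'k) trivialization set" where
  "trivs E = {t. is_triv E t \<and> (\<forall>u\<in>triv_atlas E. compatible_trivs E t u)}"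


section \<open>The tangent bundle\<close>

text \<open>
  A tangent vector at \<open>p\<close> is a family of coordinate vectors, one for every chart at \<open>p\<close>,
  transforming with the Jacobians of the coordinate changes (and \<open>0\<close> at all other charts, to
  make the family unique). The induced fiber coordinates of a chart evaluate this family at
  the chart.
\<close>

type_synonym ('p, 'm) tangent = "'p \<times> (('p, 'm) chart \<Rightarrow> real^'m)"

definition tangent_vectors :: "('p, 'm::finite) manifold \<Rightarrow> ('p, 'm) tangent set" where
  "tangent_vectors M = {(p, v). p \<in> topspace (mtop M) \<and>
     (\<forall>c. \<not> (c \<in> charts M \<and> p \<in> fst c) \<longrightarrow> v c = 0) \<and>
     (\<forall>c\<in>charts M. \<forall>d\<in>charts M. p \<in> fst c \<inter> fst d \<longrightarrow>
        v d = frechet_derivative (snd d \<circ> chart_inv c) (at (snd c p)) (v c))}"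

definition tangent_triv :: "('p, 'm::finite) chart \<Rightarrow> ('p, ('p, 'm) tangent, 'm) trivialization" where
  "tangent_triv c = (fst c, \<lambda>(p, v). v c)"

definition tangent_bundle ::
    "('p, 'm::finite) manifold \<Rightarrow> ('p, 'm, ('p, 'm) tangent, 'm) vbundle" where
  "tangent_bundle M =
     \<lparr> base = M, total = tangent_vectors M, proj = fst,
       fadd = (\<lambda>(p, v) (q, w). (p, \<lambda>c. v c + w c)),
       fscale = (\<lambda>a (p, v). (p, \<lambda>c. a *\<^sub>R v c)),
       triv_atlas = tangent_triv ` charts M \<rparr>"


section \<open>First jets and linear connections\<close>

definition local_section ::
    "('p, 'm::finite, 'e, 'k::finite) vbundle \<Rightarrow> 'p set \<Rightarrow> ('p \<Rightarrow> 'e) \<Rightarrow> bool" where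
  "local_section E W s \<longleftrightarrow>
     openin (mtop (base E)) W \<and> (\<forall>p\<in>W. s p \<in> fiber E p) \<and>
     (\<forall>t\<in>trivs E. smooth_fun_on (base E) (fst t \<inter> W) (snd t \<circ> s))"

definition sections_at :: "('p, 'm::finite, 'e, 'k::finite) vbundle \<Rightarrow> 'p \<Rightarrow> ('p \<Rightarrow> 'e) set" where
  "sections_at E p = {s. \<exists>W. p \<in> W \<and> local_section E W s}"

text \<open>Matrix of the first derivatives \<open>\<partial>\<^sub>\<kappa> s\<^sup>i\<close> at \<open>p\<close>, acting on \<open>u\<close>.\<close>

definition section_deriv ::
    "('p, 'm::finite) chart \<Rightarrow> ('p, 'e, 'k::finite) trivialization \<Rightarrow> ('p \<Rightarrow> 'e) \<Rightarrow> 'p \<Rightarrow>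
      real^'m \<Rightarrow> real^'k" where
  "section_deriv c t s p u = frechet_derivative (snd t \<circ> s \<circ> chart_inv c) (at (snd c p)) u"

text \<open>
  An element of \<open>J\<^sup>1E\<close> is a base point together with a class of local sections that have the
  same value and the same first derivatives there.
\<close>

type_synonym ('p, 'e) jet = "'p \<times> ('p \<Rightarrow> 'e) set"

definition jet1 ::
    "('p, 'm::finite, 'e, 'k::finite) vbundle \<Rightarrow> ('p \<Rightarrow> 'e) \<Rightarrow> 'p \<Rightarrow> ('p, 'e) jet" where
  "jet1 E s p = (p, {r \<in> sections_at E p. r p = s p \<and>
     (\<forall>c\<in>charts (base E). \<forall>t\<in>trivs E. p \<in> fst c \<inter> fst t \<longrightarrow>
        section_deriv c t r p = section_deriv c t s p)})"

text \<open>The jet coordinate \<open>y\<^sup>i\<^sub>\<kappa>\<close>; it does not depend on the chosen representative.\<close>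

definition jet_coord ::
    "('p, 'm::finite) chart \<Rightarrow> ('p, 'e, 'k::finite) trivialization \<Rightarrow> 'k \<Rightarrow> 'm \<Rightarrow>
      ('p, 'e) jet \<Rightarrow> real" where
  "jet_coord c t i \<kappa> J = section_deriv c t (SOME s. s \<in> snd J) (fst J) (axis \<kappa> 1) $ i"

text \<open>
  A linear connection is a smooth linear splitting \<open>K : E \<rightarrow> J\<^sup>1E\<close>; the vector space structure
  of the jets at a point is induced by the pointwise operations on sections, and smoothness
  is smoothness of the coordinate expressions \<open>y\<^sup>i\<^sub>\<kappa> \<circ> K\<close> in the fiber coordinates \<open>(x, y)\<close>.
\<close>

definition linear_connection ::
    "('p, 'm::finite, 'e, 'k::finite) vbundle \<Rightarrow> ('e \<Rightarrow> ('p, 'e) jet) \<Rightarrow> bool" where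
  "linear_connection E K \<longleftrightarrow>
     (\<forall>p. \<forall>e\<in>fiber E p. \<exists>s\<in>sections_at E p. s p = e \<and> K e = jet1 E s p) \<and>
     (\<forall>p. \<forall>e\<in>fiber E p. \<forall>f\<in>fiber E p. \<forall>r\<in>snd (K e). \<forall>s\<in>snd (K f).
        K (fadd E e f) = jet1 E (\<lambda>q. fadd E (r q) (s q)) p) \<and>
     (\<forall>p a. \<forall>e\<in>fiber E p. \<forall>s\<in>snd (K e).
        K (fscale E a e) = jet1 E (\<lambda>q. fscale E a (s q)) p) \<and>
     (\<forall>c\<in>charts (base E). \<forall>t\<in>trivs E. \<forall>i \<kappa>.
        smooth_on ((snd c ` (fst c \<inter> fst t)) \<times> UNIV)
          (\<lambda>(\<xi>, \<eta>). jet_coord c t i \<kappa> (K (fvec E t (chart_inv c \<xi>) \<eta>))))"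

text \<open>
  The coefficients \<open>K\<^sub>j\<^sup>i\<^sub>\<kappa>\<close>, as functions of the base coordinates: \<open>y\<^sup>i\<^sub>\<kappa> \<circ> K = K\<^sub>j\<^sup>i\<^sub>\<kappa> y\<^sup>j\<close>.
  With this sign the covariant differential of a section is \<open>\<partial>\<^sub>\<kappa> \<phi>\<^sup>i - K\<^sub>j\<^sup>i\<^sub>\<kappa> \<phi>\<^sup>j\<close>.
\<close>

type_synonym ('j, 'm) coefficients = "'j \<Rightarrow> 'j \<Rightarrow> 'm \<Rightarrow> real^'m \<Rightarrow> real"

definition conn_coeff ::
    "('p, 'm::finite, 'e, 'k::finite) vbundle \<Rightarrow> ('e \<Rightarrow> ('p, 'e) jet) \<Rightarrow>
      ('p, 'm) chart \<Rightarrow> ('p, 'e, 'k) trivialization \<Rightarrow> ('k, 'm) coefficients" where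
  "conn_coeff E K c t j i \<kappa> \<xi> =
     jet_coord c t i \<kappa> (K (fvec E t (chart_inv c \<xi>) (axis j 1)))"

definition classical_coeff ::
    "('p, 'm::finite) manifold \<Rightarrow> (('p, 'm) tangent \<Rightarrow> ('p, ('p, 'm) tangent) jet) \<Rightarrow>
      ('p, 'm) chart \<Rightarrow> ('m, 'm) coefficients" where
  "classical_coeff M \<Gamma> c = conn_coeff (tangent_bundle M) \<Gamma> c (tangent_triv c)"

definition classical_connection ::
    "('p, 'm::finite) manifold \<Rightarrow> (('p, 'm) tangent \<Rightarrow> ('p, ('p, 'm) tangent) jet) \<Rightarrow> bool" where
  "classical_connection M \<Gamma> \<longleftrightarrow>
     linear_connection (tangent_bundle M) \<Gamma> \<and>
     (\<forall>c\<in>charts M. \<forall>\<xi>\<in>snd c ` fst c. \<forall>\<mu> \<kappa> \<nu>.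
        classical_coeff M \<Gamma> c \<mu> \<kappa> \<nu> \<xi> = classical_coeff M \<Gamma> c \<nu> \<kappa> \<mu> \<xi>)"


section \<open>Curvature\<close>

text \<open>
  The Froelicher-Nijenhuis bracket of two tangent-valued 1-forms, as a tangent-valued 2-form
  evaluated on two vector fields:
  \<open>[\<phi>,\<psi>](X,Y) = [\<phi>X,\<psi>Y] - [\<phi>Y,\<psi>X] - \<psi>([\<phi>X,Y] - [\<phi>Y,X]) - \<phi>([\<psi>X,Y] - [\<psi>Y,X]) + (\<phi>\<psi> + \<psi>\<phi>)[X,Y]\<close>.
\<close>

definition lie_bracket ::
    "('z::real_normed_vector \<Rightarrow> 'z) \<Rightarrow> ('z \<Rightarrow> 'z) \<Rightarrow> 'z \<Rightarrow> 'z" where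
  "lie_bracket X Y z =
     frechet_derivative Y (at z) (X z) - frechet_derivative X (at z) (Y z)"

definition FN_bracket ::
    "('z::real_normed_vector \<Rightarrow> 'z \<Rightarrow> 'z) \<Rightarrow> ('z \<Rightarrow> 'z \<Rightarrow> 'z) \<Rightarrow>
      ('z \<Rightarrow> 'z) \<Rightarrow> ('z \<Rightarrow> 'z) \<Rightarrow> 'z \<Rightarrow> 'z" where
  "FN_bracket \<phi> \<psi> X Y z =
     (let \<phi>X = (\<lambda>z. \<phi> z (X z)); \<phi>Y = (\<lambda>z. \<phi> z (Y z));
          \<psi>X = (\<lambda>z. \<psi> z (X z)); \<psi>Y = (\<lambda>z. \<psi> z (Y z))
      in lie_bracket \<phi>X \<psi>Y z - lie_bracket \<phi>Y \<psi>X z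
         - \<psi> z (lie_bracket \<phi>X Y z - lie_bracket \<phi>Y X z)
         - \<phi> z (lie_bracket \<psi>X Y z - lie_bracket \<psi>Y X z)
         + \<phi> z (\<psi> z (lie_bracket X Y z)) + \<psi> z (\<phi> z (lie_bracket X Y z)))"

text \<open>
  The coordinate expression \<open>d\<^sup>\<kappa> \<otimes> (\<partial>\<^sub>\<kappa> + K\<^sub>j\<^sup>i\<^sub>\<kappa> y\<^sup>j \<partial>\<^sub>i)\<close> of a linear connection as a tangent-valued
  1-form, in the coordinates \<open>(\<xi>, \<eta>) = (x, y)\<close> of the total space.
\<close>

definition connection_form ::
    "('k::finite, 'm::finite) coefficients \<Rightarrow>
      (real^'m) \<times> (real^'k) \<Rightarrow> (real^'m) \<times> (real^'k) \<Rightarrow> (real^'m) \<times> (real^'k)" where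
  "connection_form C = (\<lambda>(\<xi>, \<eta>) (u, w).
     (u, \<chi> i. \<Sum>\<kappa>\<in>UNIV. \<Sum>j\<in>UNIV. C j i \<kappa> \<xi> * \<eta> $ j * u $ \<kappa>))"

definition curvature_form ::
    "('k::finite, 'm::finite) coefficients \<Rightarrow> ((real^'m) \<times> (real^'k) \<Rightarrow> (real^'m) \<times> (real^'k)) \<Rightarrow>
      ((real^'m) \<times> (real^'k) \<Rightarrow> (real^'m) \<times> (real^'k)) \<Rightarrow>
      (real^'m) \<times> (real^'k) \<Rightarrow> (real^'m) \<times> (real^'k)" where
  "curvature_form C X Y z = - FN_bracket (connection_form C) (connection_form C) X Y z"

text \<open>
  \<open>R[K] = - [K, K]\<close> is vertical and linear along the fibers, so that its component with index
  \<open>j\<close> is its value at \<open>b\<^sub>j\<close>. In \<open>R\<^sub>j\<^sup>i\<^sub>\<kappa>\<^sub>\<mu> d\<^sup>\<kappa> \<and> d\<^sup>\<mu>\<close> the sum is over all \<open>\<kappa>, \<mu>\<close>, hence the value of the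
  2-form on \<open>\<partial>\<^sub>\<kappa>, \<partial>\<^sub>\<mu>\<close> is twice the (antisymmetric) component.
\<close>

definition curvature ::
    "('k::finite, 'm::finite) coefficients \<Rightarrow> 'k \<Rightarrow> 'k \<Rightarrow> 'm \<Rightarrow> 'm \<Rightarrow> real^'m \<Rightarrow> real" where
  "curvature C j i \<kappa> \<mu> \<xi> =
     snd (curvature_form C (\<lambda>_. (axis \<kappa> 1, 0)) (\<lambda>_. (axis \<mu> 1, 0)) (\<xi>, axis j 1)) $ i / 2"


section \<open>Tensor product connections and the covariant differential\<close>

definition dual_conn :: "('j, 'm) coefficients \<Rightarrow> ('j, 'm) coefficients" where
  "dual_conn A = (\<lambda>j i \<kappa> \<xi>. - A i j \<kappa> \<xi>)"

definition tensor_conn ::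
    "('j, 'm) coefficients \<Rightarrow> ('l, 'm) coefficients \<Rightarrow> ('j \<times> 'l, 'm) coefficients"
    (infixr "\<otimes>\<^sub>c" 70) where
  "A \<otimes>\<^sub>c B = (\<lambda>(j, a) (i, b) \<kappa> \<xi>.
     A j i \<kappa> \<xi> * (if a = b then 1 else 0) + (if j = i then 1 else 0) * B a b \<kappa> \<xi>)"

text \<open>\<open>\<partial>\<^sub>\<nu> \<phi>\<^sup>i - A\<^sub>j\<^sup>i\<^sub>\<nu> \<phi>\<^sup>j\<close>\<close>

definition cov_diff ::
    "('j::finite, 'm::finite) coefficients \<Rightarrow> ('j \<Rightarrow> real^'m \<Rightarrow> real) \<Rightarrow>
      'j \<Rightarrow> 'm \<Rightarrow> real^'m \<Rightarrow> real" where
  "cov_diff A \<phi> i \<nu> \<xi> = pderiv_at (\<phi> i) \<nu> \<xi> - (\<Sum>j\<in>UNIV. A j i \<nu> \<xi> * \<phi> j \<xi>)"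

text \<open>
  The components \<open>R[K]\<^sub>j\<^sup>i\<^sub>\<kappa>\<^sub>\<mu>\<^sub>;\<^sub>\<nu>\<close> of \<open>\<nabla> R[K]\<close> for the connection induced by \<open>K\<^sup>*, K, \<Gamma>\<^sup>*, \<Gamma>\<^sup>*\<close> on
  \<open>E\<^sup>* \<otimes> E \<otimes> T\<^sup>*M \<otimes> T\<^sup>*M\<close>, which contains \<open>E\<^sup>* \<otimes> E \<otimes> \<Lambda>\<^sup>2T\<^sup>*M\<close>. Here \<open>C\<close> and \<open>G\<close> are the coefficients
  of \<open>K\<close> and \<open>\<Gamma>\<close>.
\<close>

definition cov_diff_curvature ::
    "('k::finite, 'm::finite) coefficients \<Rightarrow> ('m, 'm) coefficients \<Rightarrow>
      'k \<Rightarrow> 'k \<Rightarrow> 'm \<Rightarrow> 'm \<Rightarrow> 'm \<Rightarrow> real^'m \<Rightarrow> real" where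
  "cov_diff_curvature C G j i \<kappa> \<mu> \<nu> \<xi> =
     cov_diff (dual_conn C \<otimes>\<^sub>c C \<otimes>\<^sub>c dual_conn G \<otimes>\<^sub>c dual_conn G)
       (\<lambda>(j, i, \<kappa>, \<mu>). curvature C j i \<kappa> \<mu>) (j, i, \<kappa>, \<mu>) \<nu> \<xi>"


section \<open>The coordinate expressions of \<open>R[K]\<close> and \<open>\<nabla> R[K]\<close>\<close>

lemma has_derivative_vec_nth_all:
  fixes g :: "'a::real_normed_vector \<Rightarrow> real^'k"
  assumes "\<And>i. ((\<lambda>x. g x $ i) has_derivative (\<lambda>h. g' h $ i)) (at x)"
  shows "(g has_derivative g') (at x)"
  unfolding has_derivative_componentwise_within[of g]
  using assms by (auto simp: Basis_vec_def inner_axis)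

lemma connection_form_axis:
  "connection_form C z (axis \<kappa> 1, 0) = (axis \<kappa> 1, \<chi> i. \<Sum>j\<in>UNIV. C j i \<kappa> (fst z) * snd z $ j)"
proof -
  have "(\<Sum>k\<in>UNIV. \<Sum>j\<in>UNIV. C j i k (fst z) * snd z $ j * axis \<kappa> 1 $ k) = (\<Sum>j\<in>UNIV. C j i \<kappa> (fst z) * snd z $ j)" for i
    by (subst sum.swap) (simp add: axis_def if_distrib cong: if_cong)
  then show ?thesis by (auto simp: connection_form_def case_prod_beta)
qed

lemma connection_form_vertical: "connection_form C z (0, w) = 0"
  by (simp add: connection_form_def case_prod_beta zero_prod_def vec_eq_iff)

lemma curvature_eq:
  fixes C :: "('k::finite, 'm::finite) coefficients"
  assumes d: "\<And>j i \<kappa>. C j i \<kappa> differentiable (at \<xi>)"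
  shows "curvature C j i \<kappa> \<mu> \<xi> =
     pderiv_at (C j i \<kappa>) \<mu> \<xi> - pderiv_at (C j i \<mu>) \<kappa> \<xi>
     + (\<Sum>p\<in>UNIV. C j p \<mu> \<xi> * C p i \<kappa> \<xi>) - (\<Sum>p\<in>UNIV. C j p \<kappa> \<xi> * C p i \<mu> \<xi>)"
proof -
  define F where "F \<kappa> = (\<lambda>z::(real^'m)\<times>(real^'k). connection_form C z (axis \<kappa> 1, 0))" for \<kappa>
  define D where "D \<kappa> = (\<lambda>\<eta> (u,w). (0::real^'m, \<chi> i. \<Sum>j\<in>UNIV. C j i \<kappa> \<xi> * w $ j + frechet_derivative (C j i \<kappa>) (at \<xi>) u * \<eta> $ j) :: (real^'m)\<times>(real^'k))" for \<kappa>
  have Feq: "F \<kappa> = (\<lambda>z. (axis \<kappa> 1, \<chi> i. \<Sum>j\<in>UNIV. C j i \<kappa> (fst z) * snd z $ j))" for \<kappa>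
    by (simp add: F_def connection_form_axis)
  have dC: "((\<lambda>z. C j i \<kappa> (fst z)) has_derivative (\<lambda>z. frechet_derivative (C j i \<kappa>) (at \<xi>) (fst z))) (at (\<xi>,\<eta>))" for j i \<kappa> and \<eta> :: "real^'k"
  proof -
    have "(C j i \<kappa> has_derivative frechet_derivative (C j i \<kappa>) (at \<xi>)) (at (fst (\<xi>,\<eta>)))"
      using d[of j i \<kappa>] unfolding frechet_derivative_works by simp
    from has_derivative_compose[OF has_derivative_fst[OF has_derivative_ident] this] show ?thesis .
  qed
  have hd: "(F \<kappa> has_derivative D \<kappa> \<eta>) (at (\<xi>,\<eta>))" for \<kappa> \<eta>
    unfolding Feq D_def case_prod_beta
    by (intro has_derivative_Pair has_derivative_const has_derivative_vec_nth_all)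
      (auto intro!: derivative_eq_intros dC bounded_linear.has_derivative[OF bounded_linear_vec_nth])
  have fd: "frechet_derivative (F \<kappa>) (at (\<xi>,\<eta>)) = D \<kappa> \<eta>" for \<kappa> \<eta>
    using frechet_derivative_at[OF hd] by simp
  have lF: "lie_bracket (F \<kappa>) (\<lambda>_. (axis \<mu> 1, 0)) (\<xi>,\<eta>) = (0, - snd (D \<kappa> \<eta> (axis \<mu> 1, 0)))" for \<kappa> \<mu> \<eta>
    by (simp add: lie_bracket_def fd) (simp add: D_def)
  have l0: "lie_bracket (\<lambda>_. a) (\<lambda>_. b) z = 0" for a b z :: "(real^'m)\<times>(real^'k)"
    by (simp add: lie_bracket_def)
  have v: "connection_form C z 0 = 0" for z using connection_form_vertical[of C z 0] by (simp add: zero_prod_def)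
  let ?X = "\<lambda>_. (axis \<kappa> 1, 0) :: (real^'m)\<times>(real^'k)" and ?Y = "\<lambda>_. (axis \<mu> 1, 0) :: (real^'m)\<times>(real^'k)"
  have "curvature_form C ?X ?Y (\<xi>, \<eta>) = - 2 *\<^sub>R lie_bracket (F \<kappa>) (F \<mu>) (\<xi>,\<eta>)" for \<eta>
    unfolding curvature_form_def FN_bracket_def Let_def F_def[symmetric] lF l0 v
    by (simp add: connection_form_vertical scaleR_2) (simp add: lie_bracket_def)
  then have 1: "curvature C j i \<kappa> \<mu> \<xi> = - snd (lie_bracket (F \<kappa>) (F \<mu>) (\<xi>, axis j 1)) $ i"
    by (simp add: curvature_def)
  have s: "(\<Sum>p\<in>UNIV. f p * axis j 1 $ p) = (f j :: real)" for f and j::'k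
    by (simp add: axis_def if_distrib cong: if_cong)
  have Fv: "F \<kappa> (\<xi>, axis j 1) = (axis \<kappa> 1, \<chi> i. C j i \<kappa> \<xi>)" for \<kappa>
    by (simp add: Feq s)
  show ?thesis unfolding 1 lie_bracket_def fd Fv
    by (simp add: D_def sum.distrib s pderiv_at_def) (simp add: mult.commute)
qed

lemma cov_diff_curvature_eq:
  "cov_diff_curvature C G j i \<kappa> \<mu> \<nu> \<xi> =
     pderiv_at (curvature C j i \<kappa> \<mu>) \<nu> \<xi>
     - (\<Sum>p\<in>UNIV. C p i \<nu> \<xi> * curvature C j p \<kappa> \<mu> \<xi>)
     + (\<Sum>p\<in>UNIV. C j p \<nu> \<xi> * curvature C p i \<kappa> \<mu> \<xi>)
     + (\<Sum>\<rho>\<in>UNIV. G \<kappa> \<rho> \<nu> \<xi> * curvature C j i \<rho> \<mu> \<xi>)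
     + (\<Sum>\<rho>\<in>UNIV. G \<mu> \<rho> \<nu> \<xi> * curvature C j i \<kappa> \<rho> \<xi>)"
proof -
  have u: "(UNIV::('x::finite \<times> 'y::finite) set) = UNIV \<times> UNIV" by simp
  have S: "(\<Sum>j\<in>UNIV. (if j = i then 1 else 0) * f j) = (f i::real)" for f and i::"'x::finite"
    by (simp add: if_distrib[of "\<lambda>x. x * _"] cong: if_cong)
  have cp: "(\<Sum>q\<in>UNIV \<times> UNIV. f q) = (\<Sum>p\<in>UNIV. \<Sum>a\<in>UNIV. f (p,a) :: real)" for f :: "'x::finite \<times> 'y::finite \<Rightarrow> real"
    by (simp add: sum.cartesian_product)
  have tens: "(\<Sum>q\<in>UNIV. (A \<otimes>\<^sub>c B) q (i,b) \<nu> \<xi> * \<phi> q) =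
       (\<Sum>p\<in>UNIV. A p i \<nu> \<xi> * \<phi> (p, b)) + (\<Sum>p\<in>UNIV. B p b \<nu> \<xi> * \<phi> (i, p))"
    for A :: "('x::finite, 'z::finite) coefficients" and B :: "('y::finite, 'z) coefficients" and i b \<nu> \<xi> \<phi>
  proof -
    have "(\<Sum>q\<in>UNIV. (A \<otimes>\<^sub>c B) q (i,b) \<nu> \<xi> * \<phi> q) =
       (\<Sum>p\<in>UNIV. \<Sum>a\<in>UNIV. (A p i \<nu> \<xi> * (if a = b then 1 else 0) + (if p = i then 1 else 0) * B a b \<nu> \<xi>) * \<phi> (p,a))"
      unfolding u cp by (simp add: tensor_conn_def)
    also have "\<dots> = (\<Sum>p\<in>UNIV. \<Sum>a\<in>UNIV. (if a = b then 1 else 0) * (A p i \<nu> \<xi> * \<phi> (p,a))) + (\<Sum>p\<in>UNIV. (if p = i then 1 else 0) * (\<Sum>a\<in>UNIV. B a b \<nu> \<xi> * \<phi> (p,a)))"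
      by (simp add: sum.distrib[symmetric] sum_distrib_left algebra_simps)
    also have "\<dots> = (\<Sum>p\<in>UNIV. A p i \<nu> \<xi> * \<phi> (p, b)) + (\<Sum>p\<in>UNIV. B p b \<nu> \<xi> * \<phi> (i, p))"
      by (simp only: S)
    finally show ?thesis .
  qed
  show ?thesis
    unfolding cov_diff_curvature_def cov_diff_def tens dual_conn_def
    by (simp add: sum_negf)
qed

end

theory Submission
  imports Defs
begin

text \<open>
  In local coordinates write \<open>A\<^sub>\<kappa>\<close> for the matrix of functions \<open>K\<^sub>j\<^sup>i\<^sub>\<kappa>\<close> with row index \<open>j\<close> and column
  index \<open>i\<close>. Then
  \<open>R\<^sub>\<kappa>\<^sub>\<mu> = \<partial>\<^sub>\<mu> A\<^sub>\<kappa> - \<partial>\<^sub>\<kappa> A\<^sub>\<mu> + A\<^sub>\<mu> A\<^sub>\<kappa> - A\<^sub>\<kappa> A\<^sub>\<mu>\<close>, and the part of \<open>R\<^sub>\<kappa>\<^sub>\<mu>\<^sub>;\<^sub>\<nu>\<close> that does not contain \<open>\<Gamma>\<close> is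
  \<open>\<partial>\<^sub>\<nu> R\<^sub>\<kappa>\<^sub>\<mu> + A\<^sub>\<nu> R\<^sub>\<kappa>\<^sub>\<mu> - R\<^sub>\<kappa>\<^sub>\<mu> A\<^sub>\<nu>\<close>. In the cyclic sum of these expressions the second derivatives
  cancel because they commute, the terms \<open>A \<partial>A\<close> and \<open>\<partial>A A\<close> coming from \<open>\<partial>R\<close> cancel those coming
  from the commutator with \<open>A\<^sub>\<nu>\<close>, and the cubic terms cancel by the Jacobi identity. The remaining
  terms \<open>\<Gamma> R\<close> cancel in pairs, because \<open>\<Gamma>\<close> is symmetric and \<open>R\<close> is antisymmetric in the form
  indices.

  The analytic input is therefore that the coefficients \<open>K\<^sub>j\<^sup>i\<^sub>\<kappa>\<close> are twice continuously
  differentiable on an open set (\<open>open_coordinate_domain\<close>, \<open>conn_coeff_Ck_on\<close>): they are the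
  restrictions of the jet coordinates of \<open>K\<close>, which are smooth in \<open>(x, y)\<close>, to the slices
  \<open>y = b\<^sub>j\<close>. The symmetry of second derivatives is \<open>directional_derivatives_commute\<close>. The two
  cancellations are \<open>commutator_part_cyclic\<close> and \<open>torsion_free_part_cyclic\<close>.
\<close>


section \<open>Slices of differentiable maps and symmetry of second derivatives\<close>

lemma Ck_on_cong:
  assumes "open S" "\<And>x. x \<in> S \<Longrightarrow> f x = g x" "Ck_on n S f"
  shows "Ck_on n S g"
  using assms(2,3)
proof (induction n arbitrary: f g)
  case 0
  then show ?case using continuous_on_cong[of S S f g] by simp
next
  case (Suc n)
  then have diff: "f differentiable (at x)" if "x \<in> S" for x
    using that \<open>open S\<close> by (simp add: differentiable_on_eq_differentiable_at)
  have "frechet_derivative f (at x) = frechet_derivative g (at x)" if "x \<in> S" for x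
    using frechet_derivative_transform_within_open[OF diff[OF that] \<open>open S\<close> that] Suc.prems by simp
  then have "Ck_on n S (\<lambda>x. frechet_derivative g (at x) v)" for v
    using Suc.IH[of "\<lambda>x. frechet_derivative f (at x) v" "\<lambda>x. frechet_derivative g (at x) v"] Suc.prems(2)
    by simp
  moreover have "g differentiable_on S"
    unfolding differentiable_on_def
    using Suc.prems by (auto simp: differentiable_on_def intro: differentiable_transform_within[OF _ zero_less_one])
  ultimately show ?case by simp
qed

lemma has_derivative_slice:
  assumes "F differentiable (at (\<xi>, \<eta>))"
  shows "((\<lambda>\<xi>. F (\<xi>, \<eta>)) has_derivative (\<lambda>v. frechet_derivative F (at (\<xi>, \<eta>)) (v, 0))) (at \<xi>)"
proof -
  have "((\<lambda>\<xi>. (\<xi>, \<eta>)) has_derivative (\<lambda>v. (v, 0))) (at \<xi>)"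
    by (auto intro!: derivative_eq_intros)
  from has_derivative_compose[OF this] show ?thesis
    using assms by (simp add: frechet_derivative_works)
qed

text \<open>
  Directional derivatives of the restriction to a slice are directional derivatives of the whole
  map in directions tangent to the slice, so the order of differentiability is inherited.
\<close>

lemma Ck_on_slice:
  assumes "open U" "Ck_on n (U \<times> UNIV) F"
  shows "Ck_on n U (\<lambda>\<xi>. F (\<xi>, \<eta>))"
  using assms(2)
proof (induction n arbitrary: F)
  case 0
  then have "continuous_on (U \<times> UNIV) F" by simp
  moreover have "continuous_on U (\<lambda>\<xi>. (\<xi>, \<eta>))"
    by (intro continuous_intros)
  ultimately have "continuous_on U (\<lambda>\<xi>. F (\<xi>, \<eta>))"
    by (rule continuous_on_compose2) auto
  then show ?case by simp
next
  case (Suc n)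
  have "open (U \<times> (UNIV::'b set))"
    using \<open>open U\<close> by (intro open_Times) auto
  then have diff: "F differentiable (at (\<xi>, \<eta>))" if "\<xi> \<in> U" for \<xi>
    using Suc.prems that by (simp add: differentiable_on_eq_differentiable_at)
  note hd = has_derivative_slice[OF diff]
  have "Ck_on n U (\<lambda>\<xi>. frechet_derivative (\<lambda>\<xi>. F (\<xi>, \<eta>)) (at \<xi>) v)" for v
    using Suc.IH[of "\<lambda>z. frechet_derivative F (at z) (v, 0)"] Suc.prems
    by (intro Ck_on_cong[OF \<open>open U\<close> fun_cong[OF frechet_derivative_at[OF hd]]]) auto
  moreover have "(\<lambda>\<xi>. F (\<xi>, \<eta>)) differentiable_on U"
    using hd \<open>open U\<close> by (auto simp: differentiable_on_eq_differentiable_at differentiable_def)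
  ultimately show ?case by simp
qed

lemma DERIV_along_line:
  fixes f :: "'a::real_normed_vector \<Rightarrow> real"
  assumes "f differentiable (at (a + s *\<^sub>R v))"
  shows "DERIV (\<lambda>s. f (a + s *\<^sub>R v)) s :> frechet_derivative f (at (a + s *\<^sub>R v)) v"
proof -
  have f: "(f has_derivative frechet_derivative f (at (a + s *\<^sub>R v))) (at (a + s *\<^sub>R v))"
    using assms frechet_derivative_works by blast
  have "((\<lambda>s. a + s *\<^sub>R v) has_derivative (\<lambda>r. r *\<^sub>R v)) (at s)"
    by (auto intro!: derivative_eq_intros)
  from has_derivative_compose[OF this f]
  show ?thesis
    by (rule has_derivative_imp_has_field_derivative)
      (simp add: linear_cmul[OF has_derivative_linear[OF f]])
qed

text \<open>
  Two applications of the mean value theorem, first along \<open>v\<close> to the difference of \<open>f\<close> on two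
  opposite sides of a parallelogram, then along \<open>w\<close>. The left-hand side is symmetric in \<open>v\<close> and \<open>w\<close>,
  which is what makes second derivatives commute.
\<close>

lemma second_difference_mvt:
  fixes f :: "'a::real_normed_vector \<Rightarrow> real"
  assumes "open S" "f differentiable_on S" "(\<lambda>y. frechet_derivative f (at y) v) differentiable_on S"
    and "h > 0"
    and S: "\<And>r s. \<lbrakk>0 \<le> r; r \<le> h; 0 \<le> s; s \<le> h\<rbrakk> \<Longrightarrow> x + r *\<^sub>R v + s *\<^sub>R w \<in> S"
  obtains r s where "0 < r" "r < h" "0 < s" "s < h"
    and "f (x + h *\<^sub>R v + h *\<^sub>R w) - f (x + h *\<^sub>R v) - f (x + h *\<^sub>R w) + f x
       = h\<^sup>2 * frechet_derivative (\<lambda>y. frechet_derivative f (at y) v) (at (x + r *\<^sub>R v + s *\<^sub>R w)) w"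
proof -
  let ?g = "\<lambda>y. frechet_derivative f (at y) v"
  have diff: "f differentiable (at y)" "?g differentiable (at y)" if "y \<in> S" for y
    using assms(1-3) that by (simp_all add: differentiable_on_eq_differentiable_at)
  have "DERIV (\<lambda>r. f (x + h *\<^sub>R w + r *\<^sub>R v) - f (x + r *\<^sub>R v)) r
      :> ?g (x + h *\<^sub>R w + r *\<^sub>R v) - ?g (x + r *\<^sub>R v)" if "0 \<le> r" "r \<le> h" for r
    using S[OF that, of h] S[OF that, of 0] \<open>h > 0\<close>
    by (intro DERIV_diff DERIV_along_line diff) (simp_all add: add_ac)
  from MVT2[OF \<open>h > 0\<close> this] obtain r where r: "0 < r" "r < h" and
    first: "(f (x + h *\<^sub>R w + h *\<^sub>R v) - f (x + h *\<^sub>R v)) - (f (x + h *\<^sub>R w) - f x)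
       = h * (?g (x + h *\<^sub>R w + r *\<^sub>R v) - ?g (x + r *\<^sub>R v))"
    by auto
  have "DERIV (\<lambda>s. ?g (x + r *\<^sub>R v + s *\<^sub>R w)) s
      :> frechet_derivative ?g (at (x + r *\<^sub>R v + s *\<^sub>R w)) w" if "0 \<le> s" "s \<le> h" for s
    using S[of r s] r that by (intro DERIV_along_line diff) simp
  from MVT2[OF \<open>h > 0\<close> this] obtain s where s: "0 < s" "s < h" and
    "?g (x + r *\<^sub>R v + h *\<^sub>R w) - ?g (x + r *\<^sub>R v)
       = h * frechet_derivative ?g (at (x + r *\<^sub>R v + s *\<^sub>R w)) w"
    by auto
  with first have "f (x + h *\<^sub>R v + h *\<^sub>R w) - f (x + h *\<^sub>R v) - f (x + h *\<^sub>R w) + f x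
       = h\<^sup>2 * frechet_derivative ?g (at (x + r *\<^sub>R v + s *\<^sub>R w)) w"
    by (simp add: add_ac power2_eq_square)
  with r s that show thesis by blast
qed

text \<open>
  Both mixed derivatives are limits of the same second difference quotient, by continuity.
\<close>

theorem directional_derivatives_commute:
  fixes f :: "'a::real_normed_vector \<Rightarrow> real"
  assumes "open S" "Ck_on 2 S f" "x \<in> S"
  shows "frechet_derivative (\<lambda>y. frechet_derivative f (at y) v) (at x) w
       = frechet_derivative (\<lambda>y. frechet_derivative f (at y) w) (at x) v"
proof -
  define H where "H v w y = frechet_derivative (\<lambda>y. frechet_derivative f (at y) v) (at y) w" for v w y
  have diff: "f differentiable_on S" "(\<lambda>y. frechet_derivative f (at y) u) differentiable_on S"
    and cont: "continuous_on S (H u u')" for u u'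
    using assms(2) by (simp_all add: numeral_2_eq_2 H_def)
  have "\<bar>H v w x - H w v x\<bar> < e" if "e > 0" for e
  proof -
    have "\<forall>\<^sub>F y in nhds x. y \<in> S"
      using assms by (simp add: eventually_nhds_in_open)
    moreover have "\<forall>\<^sub>F y in nhds x. dist (H u u' y) (H u u' x) < e / 2" for u u'
    proof -
      have "isCont (H u u') x"
        using cont assms continuous_on_eq_continuous_at by blast
      then have "(H u u' \<longlongrightarrow> H u u' x) (nhds x)"
        by (simp add: isCont_def tendsto_at_iff_tendsto_nhds)
      then show ?thesis
        using \<open>e > 0\<close> by (intro tendstoD) auto
    qed
    ultimately have "\<forall>\<^sub>F y in nhds x. y \<in> S \<and> dist (H v w y) (H v w x) < e / 2
        \<and> dist (H w v y) (H w v x) < e / 2"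
      by (intro eventually_conj) auto
    then obtain d where "d > 0" and d: "\<And>y. dist y x < d \<Longrightarrow> y \<in> S
        \<and> dist (H v w y) (H v w x) < e / 2 \<and> dist (H w v y) (H w v x) < e / 2"
      unfolding eventually_nhds_metric by blast
    \<comment> \<open>The parallelogram spanned by \<open>h v\<close> and \<open>h w\<close> at \<open>x\<close> has to lie in the ball of radius \<open>d\<close>;
        the summand 1 avoids a division by 0.\<close>
    define h where "h = d / (norm v + norm w + 1)"
    have pos: "norm v + norm w + 1 > 0"
      by (simp add: add_nonneg_pos)
    then have "h > 0"
      using \<open>d > 0\<close> by (simp add: h_def)
    have close: "dist (x + r *\<^sub>R v + s *\<^sub>R w) x < d" if "0 \<le> r" "r \<le> h" "0 \<le> s" "s \<le> h" for r s
    proof -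
      have "dist (x + r *\<^sub>R v + s *\<^sub>R w) x \<le> norm (r *\<^sub>R v) + norm (s *\<^sub>R w)"
        by (simp add: dist_norm add.assoc norm_triangle_ineq del: norm_scaleR)
      also have "\<dots> \<le> h * norm v + h * norm w"
        using that by (simp add: add_mono mult_right_mono)
      also have "\<dots> < h * (norm v + norm w + 1)"
        using \<open>h > 0\<close> by (simp add: algebra_simps)
      also have "\<dots> = d"
        using pos by (simp add: h_def)
      finally show ?thesis .
    qed
    have close': "dist (x + r *\<^sub>R w + s *\<^sub>R v) x < d" if "0 \<le> r" "r \<le> h" "0 \<le> s" "s \<le> h" for r s
      using close[of s r] that by (simp add: add_ac)
    obtain r s where rs: "0 < r" "r < h" "0 < s" "s < h" and
      vw: "f (x + h *\<^sub>R v + h *\<^sub>R w) - f (x + h *\<^sub>R v) - f (x + h *\<^sub>R w) + f x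
         = h\<^sup>2 * H v w (x + r *\<^sub>R v + s *\<^sub>R w)"
      using second_difference_mvt[OF \<open>open S\<close> diff(1) diff(2) \<open>h > 0\<close>, of x v w] d close
      unfolding H_def by blast
    obtain r' s' where rs': "0 < r'" "r' < h" "0 < s'" "s' < h" and
      wv: "f (x + h *\<^sub>R w + h *\<^sub>R v) - f (x + h *\<^sub>R w) - f (x + h *\<^sub>R v) + f x
         = h\<^sup>2 * H w v (x + r' *\<^sub>R w + s' *\<^sub>R v)"
      using second_difference_mvt[OF \<open>open S\<close> diff(1) diff(2) \<open>h > 0\<close>, of x w v] d close'
      unfolding H_def by blast
    have "h\<^sup>2 * H v w (x + r *\<^sub>R v + s *\<^sub>R w) = h\<^sup>2 * H w v (x + r' *\<^sub>R w + s' *\<^sub>R v)"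
      unfolding vw[symmetric] wv[symmetric] by (simp add: add_ac)
    then have "H v w (x + r *\<^sub>R v + s *\<^sub>R w) = H w v (x + r' *\<^sub>R w + s' *\<^sub>R v)"
      using \<open>h > 0\<close> by simp
    then show ?thesis
      using d[OF close, of r s] d[OF close', of r' s'] rs rs'
      unfolding dist_real_def by linarith
  qed
  from this[of "\<bar>H v w x - H w v x\<bar>"] have "H v w x = H w v x"
    by fastforce
  then show ?thesis
    by (simp add: H_def)
qed


section \<open>The Bianchi identity for connection coefficients\<close>

lemma pderiv_at_commute:
  assumes "open U" "Ck_on 2 U f" "\<xi> \<in> U"
  shows "pderiv_at (pderiv_at f \<mu>) \<nu> \<xi> = pderiv_at (pderiv_at f \<nu>) \<mu> \<xi>"
  using directional_derivatives_commute[OF assms] by (simp add: pderiv_at_def[abs_def])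

lemma pderiv_at_curvature:
  fixes C :: "('k::finite, 'm::finite) coefficients"
  assumes "open U" and C: "\<And>j i \<kappa>. Ck_on 2 U (C j i \<kappa>)" and "\<xi> \<in> U"
  shows "pderiv_at (curvature C j i \<kappa> \<mu>) \<nu> \<xi> =
     pderiv_at (pderiv_at (C j i \<kappa>) \<mu>) \<nu> \<xi> - pderiv_at (pderiv_at (C j i \<mu>) \<kappa>) \<nu> \<xi>
     + (\<Sum>p\<in>UNIV. pderiv_at (C j p \<mu>) \<nu> \<xi> * C p i \<kappa> \<xi> + C j p \<mu> \<xi> * pderiv_at (C p i \<kappa>) \<nu> \<xi>)
     - (\<Sum>p\<in>UNIV. pderiv_at (C j p \<kappa>) \<nu> \<xi> * C p i \<mu> \<xi> + C j p \<kappa> \<xi> * pderiv_at (C p i \<mu>) \<nu> \<xi>)"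
proof -
  have diff: "C j i \<kappa> differentiable (at \<zeta>)" "pderiv_at (C j i \<kappa>) \<mu> differentiable (at \<zeta>)"
    if "\<zeta> \<in> U" for j i \<kappa> \<mu> \<zeta>
    using C[of j i \<kappa>] that \<open>open U\<close>
    by (simp_all add: numeral_2_eq_2 differentiable_on_eq_differentiable_at pderiv_at_def[abs_def])
  have hd: "(C j i \<kappa> has_derivative frechet_derivative (C j i \<kappa>) (at \<xi>)) (at \<xi>)"
    "(pderiv_at (C j i \<kappa>) \<mu> has_derivative frechet_derivative (pderiv_at (C j i \<kappa>) \<mu>) (at \<xi>)) (at \<xi>)"
    for j i \<kappa> \<mu>
    using diff \<open>\<xi> \<in> U\<close> frechet_derivative_works by blast+
  let ?R = "\<lambda>\<zeta>. pderiv_at (C j i \<kappa>) \<mu> \<zeta> - pderiv_at (C j i \<mu>) \<kappa> \<zeta>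
     + (\<Sum>p\<in>UNIV. C j p \<mu> \<zeta> * C p i \<kappa> \<zeta>) - (\<Sum>p\<in>UNIV. C j p \<kappa> \<zeta> * C p i \<mu> \<zeta>)"
  let ?R' = "\<lambda>v. frechet_derivative (pderiv_at (C j i \<kappa>) \<mu>) (at \<xi>) v
     - frechet_derivative (pderiv_at (C j i \<mu>) \<kappa>) (at \<xi>) v
     + (\<Sum>p\<in>UNIV. C j p \<mu> \<xi> * frechet_derivative (C p i \<kappa>) (at \<xi>) v
         + frechet_derivative (C j p \<mu>) (at \<xi>) v * C p i \<kappa> \<xi>)
     - (\<Sum>p\<in>UNIV. C j p \<kappa> \<xi> * frechet_derivative (C p i \<mu>) (at \<xi>) v
         + frechet_derivative (C j p \<kappa>) (at \<xi>) v * C p i \<mu> \<xi>)"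
  have "(?R has_derivative ?R') (at \<xi>)"
    by (intro has_derivative_add has_derivative_diff has_derivative_sum has_derivative_mult hd)
  then have "(curvature C j i \<kappa> \<mu> has_derivative ?R') (at \<xi>)"
    by (rule has_derivative_transform_within_open[OF _ \<open>open U\<close> \<open>\<xi> \<in> U\<close>])
      (simp add: curvature_eq[where C = C] diff)
  from frechet_derivative_at[OF this, symmetric] show ?thesis
    unfolding pderiv_at_def[of "curvature C j i \<kappa> \<mu>"]
    by (simp add: pderiv_at_def[of "C _ _ _"] pderiv_at_def[of "pderiv_at _ _"] add.commute)
qed

text \<open>
  The sums \<open>L\<close>, \<open>M\<close> and \<open>T\<close> in the proof are the entries at \<open>(j, i)\<close> of the matrix products
  \<open>A\<^sub>\<alpha> \<partial>\<^sub>\<gamma> A\<^sub>\<beta>\<close>, \<open>(\<partial>\<^sub>\<beta> A\<^sub>\<alpha>) A\<^sub>\<gamma>\<close> and \<open>A\<^sub>\<alpha> A\<^sub>\<beta> A\<^sub>\<gamma>\<close>. Once everything is expressed through them and the second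
  derivatives, the cyclic sum vanishes by linear arithmetic.
\<close>

lemma commutator_part_cyclic:
  fixes C :: "('k::finite, 'm::finite) coefficients" and j i :: 'k
  assumes "open U" and C: "\<And>j i \<kappa>. Ck_on 2 U (C j i \<kappa>)" and "\<xi> \<in> U"
  defines "B \<equiv> \<lambda>\<kappa> \<mu> \<nu>. pderiv_at (curvature C j i \<kappa> \<mu>) \<nu> \<xi>
     - (\<Sum>p\<in>UNIV. C p i \<nu> \<xi> * curvature C j p \<kappa> \<mu> \<xi>)
     + (\<Sum>p\<in>UNIV. C j p \<nu> \<xi> * curvature C p i \<kappa> \<mu> \<xi>)"
  shows "B \<kappa> \<mu> \<nu> + B \<mu> \<nu> \<kappa> + B \<nu> \<kappa> \<mu> = 0"
proof -
  define D where "D \<alpha> \<beta> \<gamma> = pderiv_at (pderiv_at (C j i \<alpha>) \<beta>) \<gamma> \<xi>" for \<alpha> \<beta> \<gamma>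
  define L where "L \<alpha> \<beta> \<gamma> = (\<Sum>p\<in>UNIV. C j p \<alpha> \<xi> * pderiv_at (C p i \<beta>) \<gamma> \<xi>)" for \<alpha> \<beta> \<gamma>
  define M where "M \<alpha> \<beta> \<gamma> = (\<Sum>p\<in>UNIV. pderiv_at (C j p \<alpha>) \<beta> \<xi> * C p i \<gamma> \<xi>)" for \<alpha> \<beta> \<gamma>
  define T where "T \<alpha> \<beta> \<gamma> = (\<Sum>p\<in>UNIV. \<Sum>q\<in>UNIV. C j p \<alpha> \<xi> * C p q \<beta> \<xi> * C q i \<gamma> \<xi>)" for \<alpha> \<beta> \<gamma>
  have diff: "C j i \<kappa> differentiable (at \<xi>)" for j i \<kappa>
    using C[of j i \<kappa>] \<open>\<xi> \<in> U\<close> \<open>open U\<close>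
    by (simp add: numeral_2_eq_2 differentiable_on_eq_differentiable_at)
  note R = curvature_eq[where C = C, OF diff]
  have D_commute: "D \<alpha> \<beta> \<gamma> = D \<alpha> \<gamma> \<beta>" for \<alpha> \<beta> \<gamma>
    unfolding D_def by (rule pderiv_at_commute[OF \<open>open U\<close> C \<open>\<xi> \<in> U\<close>])
  have "pderiv_at (curvature C j i \<kappa> \<mu>) \<nu> \<xi>
      = D \<kappa> \<mu> \<nu> - D \<mu> \<kappa> \<nu> + M \<mu> \<nu> \<kappa> + L \<mu> \<kappa> \<nu> - M \<kappa> \<nu> \<mu> - L \<kappa> \<mu> \<nu>" for \<kappa> \<mu> \<nu>
    unfolding pderiv_at_curvature[where C = C, OF \<open>open U\<close> C \<open>\<xi> \<in> U\<close>]
    by (simp add: D_def L_def M_def sum.distrib)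
  moreover have "(\<Sum>p\<in>UNIV. C p i \<nu> \<xi> * curvature C j p \<kappa> \<mu> \<xi>)
      = M \<kappa> \<mu> \<nu> - M \<mu> \<kappa> \<nu> + T \<mu> \<kappa> \<nu> - T \<kappa> \<mu> \<nu>" for \<kappa> \<mu> \<nu>
  proof -
    have "T \<alpha> \<beta> \<gamma> = (\<Sum>p\<in>UNIV. C p i \<gamma> \<xi> * (\<Sum>q\<in>UNIV. C j q \<alpha> \<xi> * C q p \<beta> \<xi>))" for \<alpha> \<beta> \<gamma>
      unfolding T_def by (subst sum.swap) (simp add: sum_distrib_left mult_ac)
    then show ?thesis
      by (simp add: R M_def sum.distrib sum_subtractf distrib_left right_diff_distrib mult.commute)
  qed
  moreover have "(\<Sum>p\<in>UNIV. C j p \<nu> \<xi> * curvature C p i \<kappa> \<mu> \<xi>)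
      = L \<nu> \<kappa> \<mu> - L \<nu> \<mu> \<kappa> + T \<nu> \<mu> \<kappa> - T \<nu> \<kappa> \<mu>" for \<kappa> \<mu> \<nu>
    by (simp add: R L_def T_def sum.distrib sum_subtractf distrib_left right_diff_distrib
        sum_distrib_left mult.assoc)
  ultimately show ?thesis
    using D_commute[of \<kappa> \<mu> \<nu>] D_commute[of \<mu> \<nu> \<kappa>] D_commute[of \<nu> \<kappa> \<mu>]
    by (simp add: B_def)
qed

lemma torsion_free_part_cyclic:
  fixes G :: "'m::finite \<Rightarrow> 'm \<Rightarrow> 'm \<Rightarrow> real" and R :: "'m \<Rightarrow> 'm \<Rightarrow> real"
  assumes G: "\<And>\<kappa> \<rho> \<nu>. G \<kappa> \<rho> \<nu> = G \<nu> \<rho> \<kappa>" and R: "\<And>\<kappa> \<mu>. R \<kappa> \<mu> = - R \<mu> \<kappa>"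
  defines "Q \<equiv> \<lambda>\<kappa> \<mu> \<nu>. (\<Sum>\<rho>\<in>UNIV. G \<kappa> \<rho> \<nu> * R \<rho> \<mu>) + (\<Sum>\<rho>\<in>UNIV. G \<mu> \<rho> \<nu> * R \<kappa> \<rho>)"
  shows "Q \<kappa> \<mu> \<nu> + Q \<mu> \<nu> \<kappa> + Q \<nu> \<kappa> \<mu> = 0"
proof -
  define S where "S \<alpha> \<beta> \<gamma> = (\<Sum>\<rho>\<in>UNIV. G \<alpha> \<rho> \<beta> * R \<rho> \<gamma>)" for \<alpha> \<beta> \<gamma>
  have "(\<Sum>\<rho>\<in>UNIV. G \<alpha> \<rho> \<beta> * R \<gamma> \<rho>) = - S \<alpha> \<beta> \<gamma>" for \<alpha> \<beta> \<gamma>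
    unfolding S_def sum_negf[symmetric] by (subst R) simp
  then have "Q \<kappa> \<mu> \<nu> = S \<kappa> \<nu> \<mu> - S \<mu> \<nu> \<kappa>" for \<kappa> \<mu> \<nu>
    by (simp add: Q_def S_def)
  moreover have "S \<alpha> \<beta> \<gamma> = S \<beta> \<alpha> \<gamma>" for \<alpha> \<beta> \<gamma>
    unfolding S_def by (subst G) simp
  ultimately show ?thesis
    by simp
qed

theorem cov_diff_curvature_cyclic:
  fixes C :: "('k::finite, 'm::finite) coefficients"
  assumes "open U" and C: "\<And>j i \<kappa>. Ck_on 2 U (C j i \<kappa>)" and "\<xi> \<in> U"
    and G: "\<And>\<kappa> \<rho> \<nu>. G \<kappa> \<rho> \<nu> \<xi> = G \<nu> \<rho> \<kappa> \<xi>"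
  shows "cov_diff_curvature C G j i \<kappa> \<mu> \<nu> \<xi> + cov_diff_curvature C G j i \<mu> \<nu> \<kappa> \<xi>
       + cov_diff_curvature C G j i \<nu> \<kappa> \<mu> \<xi> = 0"
proof -
  have diff: "C j i \<kappa> differentiable (at \<xi>)" for j i \<kappa>
    using C[of j i \<kappa>] \<open>\<xi> \<in> U\<close> \<open>open U\<close>
    by (simp add: numeral_2_eq_2 differentiable_on_eq_differentiable_at)
  have "curvature C j i \<alpha> \<beta> \<xi> = - curvature C j i \<beta> \<alpha> \<xi>" for \<alpha> \<beta>
    by (simp add: curvature_eq[where C = C, OF diff])
  note torsion_free_part_cyclic[where G = "\<lambda>\<kappa> \<rho> \<nu>. G \<kappa> \<rho> \<nu> \<xi>"
      and R = "\<lambda>\<kappa> \<mu>. curvature C j i \<kappa> \<mu> \<xi>" and \<kappa> = \<kappa> and \<mu> = \<mu> and \<nu> = \<nu>, OF G this]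
  with commutator_part_cyclic[where C = C and j = j and i = i and \<kappa> = \<kappa> and \<mu> = \<mu> and \<nu> = \<nu>,
      OF \<open>open U\<close> C \<open>\<xi> \<in> U\<close>]
  show ?thesis
    unfolding cov_diff_curvature_eq by linarith
qed


section \<open>Coefficients of linear connections\<close>

lemma open_coordinate_domain:
  assumes "is_chart X c" "openin X V"
  shows "open (snd c ` (fst c \<inter> V))"
proof -
  have c: "openin X (fst c)" "open (snd c ` fst c)"
    "homeomorphic_map (subtopology X (fst c)) (top_of_set (snd c ` fst c)) (snd c)"
    using assms(1) by (auto simp: is_chart_def)
  have "openin (subtopology X (fst c)) (fst c \<inter> V)"
    using assms(2) by (rule openin_subtopology_Int2)
  then have "openin (top_of_set (snd c ` fst c)) (snd c ` (fst c \<inter> V))"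
    using homeomorphic_map_openness_eq[OF c(3)] by blast
  then show ?thesis
    using c(2) openin_open_trans by blast
qed

lemma conn_coeff_Ck_on:
  assumes "linear_connection E K" "c \<in> charts (base E)" "t \<in> trivs E"
  shows "Ck_on n (snd c ` (fst c \<inter> fst t)) (conn_coeff E K c t j i \<kappa>)"
proof -
  let ?U = "snd c ` (fst c \<inter> fst t)"
  let ?F = "\<lambda>(\<xi>, \<eta>). jet_coord c t i \<kappa> (K (fvec E t (chart_inv c \<xi>) \<eta>))"
  have "open ?U"
    using assms(2,3) by (intro open_coordinate_domain[of "mtop (base E)"])
      (auto simp: charts_def trivs_def is_triv_def)
  moreover have "Ck_on n (?U \<times> UNIV) ?F"
    using assms by (auto simp: linear_connection_def smooth_on_def)
  ultimately have "Ck_on n ?U (\<lambda>\<xi>. ?F (\<xi>, axis j 1))"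
    by (rule Ck_on_slice)
  then show ?thesis
    by (simp add: conn_coeff_def[abs_def])
qed

theorem theorem4p6:
  fixes E :: "('p, 'm::finite, 'e, 'k::finite) vbundle"
    and K :: "'e \<Rightarrow> ('p, 'e) jet"
    and \<Gamma> :: "('p, 'm) tangent \<Rightarrow> ('p, ('p, 'm) tangent) jet"
    and c :: "('p, 'm) chart"
    and t :: "('p, 'e, 'k) trivialization"
  assumes "smooth_vector_bundle E"
    and "linear_connection E K"
    and "classical_connection (base E) \<Gamma>"
    and "c \<in> charts (base E)"
    and "t \<in> trivs E"
    and "p \<in> fst c \<inter> fst t"
  shows "cov_diff_curvature (conn_coeff E K c t) (classical_coeff (base E) \<Gamma> c) j i \<kappa> \<mu> \<nu> (snd c p)
       + cov_diff_curvature (conn_coeff E K c t) (classical_coeff (base E) \<Gamma> c) j i \<mu> \<nu> \<kappa> (snd c p)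
       + cov_diff_curvature (conn_coeff E K c t) (classical_coeff (base E) \<Gamma> c) j i \<nu> \<kappa> \<mu> (snd c p) = 0"
proof (rule cov_diff_curvature_cyclic)
  show "open (snd c ` (fst c \<inter> fst t))"
    using assms(4,5) by (intro open_coordinate_domain[of "mtop (base E)"])
      (auto simp: charts_def trivs_def is_triv_def)
  show "Ck_on 2 (snd c ` (fst c \<inter> fst t)) (conn_coeff E K c t j i \<kappa>)" for j i \<kappa>
    using assms(2,4,5) by (rule conn_coeff_Ck_on)
  show "snd c p \<in> snd c ` (fst c \<inter> fst t)"
    using assms(6) by blast
  show "classical_coeff (base E) \<Gamma> c \<kappa> \<rho> \<nu> (snd c p) = classical_coeff (base E) \<Gamma> c \<nu> \<rho> \<kappa> (snd c p)"
    for \<kappa> \<rho> \<nu>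
    using assms(3,4,6) by (auto simp: classical_connection_def)
qed

end
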